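(* For every integer $\alpha\ge 2$ and every integer $N\ge 3$, $$\int_{N+1/2}^{\infty}\frac{dx}{x\,\log x\,(\log\log x)^{\alpha}}=\frac{1}{(\alpha-1)\left[\log\log\left(N+\tfrac12\right)\right]^{\alpha-1}}.$$
   Context: Here $\log$ is the natural logarithm and $\log\log x=\log(\log x)$. Since $N\ge 3$ gives $N+\tfrac12>e$, one has $\log\log x>0$ on the range of integration. *)

theory Defs
  imports "HOL-Analysis.Analysis"
begin

end

theory Submission imports Defs begin

text \<open>The function \<open>x \<mapsto> - 1 / ((\<alpha> - 1) (ln (ln x))^(\<alpha> - 1))\<close> is an antiderivative of the
  integrand and vanishes at infinity; the integrand is nonnegative where \<open>x > e\<close>, so the
  fundamental theorem of calculus applies on the whole half-line.\<close>

text \<open>For a nonnegative integrand the nonnegative Lebesgue integral over the half-line is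
  given by \<open>nn_integral_FTC_atLeast\<close>; extending \<open>f\<close> by zero to all of the
  real line turns that value into a gauge integral.\<close>

lemma has_integral_FTC_atLeast_nonneg:
  fixes f F :: "real \<Rightarrow> real"
  assumes meas: "f \<in> borel_measurable borel"
    and deriv: "\<And>x. a \<le> x \<Longrightarrow> (F has_real_derivative f x) (at x)"
    and nonneg: "\<And>x. a \<le> x \<Longrightarrow> 0 \<le> f x"
    and lim: "(F \<longlongrightarrow> T) at_top"
  shows "(f has_integral T - F a) {a..}"
proof -
  let ?g = "\<lambda>x. if x \<in> {a..} then f x else 0"
  \<comment> \<open>Since \<open>ennreal\<close> sends negative reals to 0, recovering the real
    value \<open>T - F a\<close> requires it to be nonnegative. Monotonicity of \<open>F\<close>
    passes to the limit and gives this.\<close>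
  have mono: "F a \<le> F x" if "a \<le> x" for x
    by (rule DERIV_nonneg_imp_nondecreasing[OF that]) (use deriv nonneg in blast)
  have "F a \<le> T"
    by (rule tendsto_lowerbound[OF lim])
       (use mono in \<open>auto intro: eventually_at_top_linorderI\<close>)
  moreover have "(\<integral>\<^sup>+x. ennreal (?g x) \<partial>lborel) = (\<integral>\<^sup>+x. ennreal (f x) * indicator {a..} x \<partial>lborel)"
    by (intro nn_integral_cong) (auto simp: indicator_def)
  moreover have "\<dots> = ennreal (T - F a)"
    by (rule nn_integral_FTC_atLeast[OF meas deriv nonneg lim])
  ultimately have "(?g has_integral T - F a) UNIV"
    using meas nonneg by (intro nn_integral_has_integral) auto
  then show ?thesis
    by (simp only: has_integral_restrict_UNIV)
qed

lemma ln_gt_one: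
  fixes x :: real
  assumes "exp 1 < x"
  shows "1 < ln x"
  using assms ln_less_cancel_iff[of "exp 1" x] less_trans[OF exp_gt_zero assms] by simp

lemma has_real_derivative_ln_ln_power:
  fixes x :: real and n :: nat
  assumes "exp 1 < x" and "0 < n"
  shows "((\<lambda>x. - 1 / (real n * ln (ln x) ^ n)) has_real_derivative
           1 / (x * ln x * ln (ln x) ^ Suc n)) (at x)"
proof -
  have l: "1 < ln x"
    by (rule ln_gt_one[OF assms(1)])
  then have ll: "0 < ln (ln x)"
    by simp
  have x1: "1 < x"
    using assms(1) exp_ge_add_one_self[of 1] by linarith
  \<comment> \<open>Writing the exponent as a successor lets the power rule lower it to
    \<open>m\<close> without truncated subtraction.\<close>
  obtain m where m: "n = Suc m"
    using assms(2) gr0_implies_Suc by blast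
  have "((\<lambda>x. ln (ln x)) has_real_derivative 1 / (x * ln x)) (at x)"
    using x1 l by (auto intro!: derivative_eq_intros simp: field_simps)
  from DERIV_power_Suc[OF this, of m]
  have "((\<lambda>x. ln (ln x) ^ n) has_real_derivative real n * ln (ln x) ^ m / (x * ln x)) (at x)"
    by (simp add: m)
  from DERIV_inverse'[OF this] ll
  have "((\<lambda>x. inverse (ln (ln x) ^ n)) has_real_derivative
      - (inverse (ln (ln x) ^ n) * (real n * ln (ln x) ^ m / (x * ln x)) * inverse (ln (ln x) ^ n))) (at x)"
    by simp
  from DERIV_cmult[OF this, of "- 1 / real n"]
  have "((\<lambda>x. - 1 / (real n * ln (ln x) ^ n)) has_real_derivative
      - 1 / real n * - (inverse (ln (ln x) ^ n) * (real n * ln (ln x) ^ m / (x * ln x)) *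
        inverse (ln (ln x) ^ n))) (at x)"
    by (simp add: divide_inverse)
  \<comment> \<open>The factor \<open>- 1 / real n\<close> cancels the \<open>n\<close> from the
    power rule, and the powers of \<open>ln (ln x)\<close> combine to the exponent m - 2n = -(n +
    1).\<close>
  moreover have pow: "ln (ln x) ^ n = ln (ln x) * ln (ln x) ^ m"
    by (simp add: m)
  ultimately show ?thesis
    by (elim DERIV_cong) (use assms(2) ll l x1 pow in \<open>simp add: field_simps\<close>)
qed

text \<open>The iterated logarithm is unbounded, so its positive powers diverge and their
  reciprocals vanish at infinity.\<close>

lemma tendsto_ln_ln_power_at_top:
  fixes n :: nat
  assumes "0 < n"
  shows "((\<lambda>x::real. - 1 / (real n * ln (ln x) ^ n)) \<longlongrightarrow> 0) at_top"
proof -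
  have "filterlim (\<lambda>x::real. ln (ln x)) at_top at_top"
    by (rule filterlim_compose[OF ln_at_top ln_at_top])
  then have "filterlim (\<lambda>x::real. real n * ln (ln x) ^ n) at_top at_top"
    using assms by (intro filterlim_tendsto_pos_mult_at_top[OF tendsto_const] filterlim_pow_at_top) auto
  then show ?thesis
    by (intro tendsto_divide_0[OF tendsto_const] filterlim_at_top_imp_at_infinity)
qed

theorem proposition1:
  fixes \<alpha> N :: nat
  assumes "\<alpha> \<ge> 2" and "N \<ge> 3"
  shows "((\<lambda>x::real. 1 / (x * ln x * (ln (ln x)) ^ \<alpha>)) has_integral
           1 / ((real \<alpha> - 1) * (ln (ln (real N + 1 / 2))) ^ (\<alpha> - 1)))
         {real N + 1 / 2..}"
proof -
  \<comment> \<open>From \<alpha> \<ge> 2 this exponent is positive, so the boundary term at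
    infinity is 0.\<close>
  define n where "n = \<alpha> - 1"
  have n: "0 < n" "\<alpha> = Suc n"
    using assms(1) by (auto simp: n_def)
  let ?f = "\<lambda>x::real. 1 / (x * ln x * ln (ln x) ^ Suc n)"
  let ?F = "\<lambda>x::real. - 1 / (real n * ln (ln x) ^ n)"
  \<comment> \<open>Here e \<le> 3 < N + 1/2, so the half-line avoids the singularity at e and
    \<open>ln (ln x)\<close> is positive on it.\<close>
  have e: "exp 1 < x" if "real N + 1 / 2 \<le> x" for x :: real
    using exp_le that assms(2) by linarith
  have "(?f has_integral 0 - ?F (real N + 1 / 2)) {real N + 1 / 2..}"
  proof (rule has_integral_FTC_atLeast_nonneg)
    show "?f \<in> borel_measurable borel"
      by measurable
    show "(?F has_real_derivative ?f x) (at x)" if "real N + 1 / 2 \<le> x" for x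
      by (rule has_real_derivative_ln_ln_power[OF e[OF that] n(1)])
    show "0 \<le> ?f x" if "real N + 1 / 2 \<le> x" for x
      using ln_gt_one[OF e[OF that]] that assms(2)
      by (intro divide_nonneg_nonneg mult_nonneg_nonneg zero_le_power) auto
    show "(?F \<longlongrightarrow> 0) at_top"
      by (rule tendsto_ln_ln_power_at_top[OF n(1)])
  qed
  then show ?thesis
    by (simp add: n(2))
qed

end
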